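(* Let $\mathcal{G}$ be a simple graph with Laplacian $L$, let $\lambda$ be an eigenvalue of $L$ associated to a bivalent/trivalent eigenvector (an eigenvector with all components in $\{-1,1\}$, respectively $\{-1,0,1\}$), and let $d_\pm,d_0$ be the associated degrees. At the critical values $$\kappa^{\mathrm{crit}}\in\left\{-\frac{1}{2c_{10}\lambda},\,-\frac{1}{2c_{01}\lambda}\right\},$$ the equilibrium at the origin of the one-degree-of-freedom system $$\dot x=y+\kappa d_\pm G_{01}(2x,2y)+\kappa d_0G_{01}(x,y),\qquad \dot y=-\sin x-\kappa d_\pm G_{10}(2x,2y)-\kappa d_0G_{10}(x,y)$$ undergoes pitchfork bifurcations.
   Context: The interaction $G:\mathbb{R}^2\to\mathbb{R}$ is analytic of the form $G(x,y)=\sum_{l,m=0}^\infty c_{lm}x^{2l}y^{2m}$ with $c_{lm}\in\mathbb{R}$, and $G\ge 0$; $G_{ij}=\frac{\partial^{i+j}G}{\partial x^i\partial y^j}$. The parameter $\kappa$ (coupling strength) is positive. The graph Laplacian is $L=D-A$ ($A=(a_{ij})$ adjacency matrix, $D$ diagonal degree matrix). For a bivalent/trivalent eigenvector $v$ of $L$ with eigenvalue $\lambda$, let $\mathcal{P},\mathcal{N},\mathcal{Z}$ be the sets of nodes $i$ with $v^i=1,-1,0$. Then $d_\pm$ is the number of nodes of $\mathcal{N}$ adjacent to a node of $\mathcal{P}$, equivalently of nodes of $\mathcal{P}$ adjacent to a node of $\mathcal{N}$, and $d_0$ is the number of nodes of $\mathcal{Z}$ adjacent to a node of $\mathcal{P}\cup\mathcal{N}$;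 these numbers are taken not to depend on the chosen node. The displayed planar system is the restriction, to the anti-synchrony space spanned by $v$ in positions and in momenta, of the system $\dot q_i=p_i+\kappa\sum_j a_{ij}G_{01}(q_i-q_j,p_i-p_j)$, $\dot p_i=-\sin q_i-\kappa\sum_j a_{ij}G_{10}(q_i-q_j,p_i-p_j)$. Pitchfork bifurcation: the origin undergoes a pitchfork bifurcation at $\kappa^{\mathrm{crit}}$ when one of the two components $h(x,y,\kappa)$ of the planar vector field is an odd function of $(x,y)$ and satisfies, along one of the two coordinates (written here for $x$; the same with $y$ in place of $x$), $h=\frac{\partial h}{\partial x}=\frac{\partial^2h}{\partial x^2}=\frac{\partial h}{\partial\kappa}=0$, $\frac{\partial^3h}{\partial x^3}\ne0$ and $\frac{\partial^2h}{\partial\kappa\,\partial x}\ne0$ at $(0,0,\kappa^{\mathrm{crit}})$.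
   Formalization: Adds the needed nonvanishing of the cubic term: c_10 λ + 12 c_20 (8 d_± + d_0) ≠ 0 at −1/(2c_10 λ), and c_02 ≠ 0 at −1/(2c_01 λ); without it the claim fails, e.g. K_2 with G = 1 − y² + y⁶. *)

theory Defs
  imports "HOL-Analysis.Analysis"
begin

definition simple_graph :: "('n \<Rightarrow> 'n \<Rightarrow> bool) \<Rightarrow> bool" where
  "simple_graph E \<longleftrightarrow> symp E \<and> irreflp E"

definition adjacency_matrix :: "('n::finite \<Rightarrow> 'n \<Rightarrow> bool) \<Rightarrow> real^'n^'n" where
  "adjacency_matrix E = (\<chi> i j. if E i j then 1 else 0)"

definition degree_matrix :: "('n::finite \<Rightarrow> 'n \<Rightarrow> bool) \<Rightarrow> real^'n^'n" where
  "degree_matrix E = (\<chi> i j. if i = j then real (card {k. E i k}) else 0)"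

definition laplacian :: "('n::finite \<Rightarrow> 'n \<Rightarrow> bool) \<Rightarrow> real^'n^'n" where
  "laplacian E = degree_matrix E - adjacency_matrix E"

definition eigenvector :: "real^'n^'n \<Rightarrow> real^'n \<Rightarrow> real \<Rightarrow> bool" where
  "eigenvector M v lam \<longleftrightarrow> v \<noteq> 0 \<and> M *v v = lam *s v"

definition bivalent :: "real^'n \<Rightarrow> bool" where
  "bivalent v \<longleftrightarrow> (\<forall>i. v $ i \<in> {-1, 1})"

definition trivalent :: "real^'n \<Rightarrow> bool" where
  "trivalent v \<longleftrightarrow> (\<forall>i. v $ i \<in> {-1, 0, 1})"

text \<open>The numbers of neighbours do not depend on the chosen node: every node with value
  \<open>\<plusminus>1\<close> has \<open>dpm\<close> neighbours of the opposite value and \<open>d0\<close> neighbours of value \<open>0\<close>.\<close>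

definition associated_degrees ::
    "('n::finite \<Rightarrow> 'n \<Rightarrow> bool) \<Rightarrow> real^'n \<Rightarrow> nat \<Rightarrow> nat \<Rightarrow> bool" where
  "associated_degrees E v dpm d0 \<longleftrightarrow>
     (let P = {i. v $ i = 1}; N = {i. v $ i = -1}; Z = {i. v $ i = 0} in
       (\<forall>i\<in>P. card {j\<in>N. E i j} = dpm) \<and>
       (\<forall>i\<in>N. card {j\<in>P. E i j} = dpm) \<and>
       (\<forall>i\<in>P \<union> N. card {j\<in>Z. E i j} = d0))"

definition mixed_partial :: "nat \<Rightarrow> nat \<Rightarrow> (real \<Rightarrow> real \<Rightarrow> real) \<Rightarrow> real \<Rightarrow> real \<Rightarrow> real" where
  "mixed_partial i j G x y = (deriv ^^ i) (\<lambda>s. (deriv ^^ j) (\<lambda>t. G s t) y) x"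

definition planar_x ::
    "(real \<Rightarrow> real \<Rightarrow> real) \<Rightarrow> nat \<Rightarrow> nat \<Rightarrow> real \<Rightarrow> real \<Rightarrow> real \<Rightarrow> real" where
  "planar_x G dpm d0 x y \<kappa> =
     y + \<kappa> * real dpm * mixed_partial 0 1 G (2 * x) (2 * y)
       + \<kappa> * real d0 * mixed_partial 0 1 G x y"

definition planar_y ::
    "(real \<Rightarrow> real \<Rightarrow> real) \<Rightarrow> nat \<Rightarrow> nat \<Rightarrow> real \<Rightarrow> real \<Rightarrow> real \<Rightarrow> real" where
  "planar_y G dpm d0 x y \<kappa> =
     - sin x - \<kappa> * real dpm * mixed_partial 1 0 G (2 * x) (2 * y)
       - \<kappa> * real d0 * mixed_partial 1 0 G x y"

definition partial_x ::
    "(real \<Rightarrow> real \<Rightarrow> real \<Rightarrow> real) \<Rightarrow> real \<Rightarrow> real \<Rightarrow> real \<Rightarrow> real" where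
  "partial_x h x y \<kappa> = deriv (\<lambda>s. h s y \<kappa>) x"

definition partial_kappa ::
    "(real \<Rightarrow> real \<Rightarrow> real \<Rightarrow> real) \<Rightarrow> real \<Rightarrow> real \<Rightarrow> real \<Rightarrow> real" where
  "partial_kappa h x y \<kappa> = deriv (\<lambda>s. h x y s) \<kappa>"

text \<open>Since \<^const>\<open>deriv\<close> is an arbitrary number where a function is not differentiable, the
  existence of the derivatives in the pitchfork conditions is required explicitly.\<close>

definition pitchfork_derivatives_exist ::
    "(real \<Rightarrow> real \<Rightarrow> real \<Rightarrow> real) \<Rightarrow> real \<Rightarrow> bool" where
  "pitchfork_derivatives_exist h \<kappa>c \<longleftrightarrow>
     (\<forall>\<^sub>F x in nhds 0. (\<lambda>s. h s 0 \<kappa>c) differentiable at x) \<and>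
     (\<forall>\<^sub>F x in nhds 0. (\<lambda>s. partial_x h s 0 \<kappa>c) differentiable at x) \<and>
     (\<lambda>s. partial_x (partial_x h) s 0 \<kappa>c) differentiable at 0 \<and>
     (\<lambda>s. h 0 0 s) differentiable at \<kappa>c \<and>
     (\<forall>\<^sub>F \<kappa> in nhds \<kappa>c. (\<lambda>s. h s 0 \<kappa>) differentiable at 0) \<and>
     (\<lambda>s. partial_x h 0 0 s) differentiable at \<kappa>c"

definition pitchfork_along_x ::
    "(real \<Rightarrow> real \<Rightarrow> real \<Rightarrow> real) \<Rightarrow> real \<Rightarrow> bool" where
  "pitchfork_along_x h \<kappa>c \<longleftrightarrow>
     pitchfork_derivatives_exist h \<kappa>c \<and>
     h 0 0 \<kappa>c = 0 \<and>
     partial_x h 0 0 \<kappa>c = 0 \<and>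
     partial_x (partial_x h) 0 0 \<kappa>c = 0 \<and>
     partial_kappa h 0 0 \<kappa>c = 0 \<and>
     partial_x (partial_x (partial_x h)) 0 0 \<kappa>c \<noteq> 0 \<and>
     partial_kappa (partial_x h) 0 0 \<kappa>c \<noteq> 0"

definition pitchfork_along_y ::
    "(real \<Rightarrow> real \<Rightarrow> real \<Rightarrow> real) \<Rightarrow> real \<Rightarrow> bool" where
  "pitchfork_along_y h \<kappa>c \<longleftrightarrow> pitchfork_along_x (\<lambda>x y. h y x) \<kappa>c"

text \<open>The arguments \<open>f\<close> and \<open>g\<close> are the two components of a planar vector field,
  depending on the position \<open>x\<close>, \<open>y\<close> and then the parameter \<open>\<kappa>\<close>.\<close>

definition pitchfork_at_origin ::
    "(real \<Rightarrow> real \<Rightarrow> real \<Rightarrow> real) \<Rightarrow> (real \<Rightarrow> real \<Rightarrow> real \<Rightarrow> real) \<Rightarrow> real \<Rightarrow> bool" where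
  "pitchfork_at_origin f g \<kappa>c \<longleftrightarrow>
     (\<exists>h\<in>{f, g}. (\<forall>x y \<kappa>. h (- x) (- y) \<kappa> = - h x y \<kappa>) \<and>
       (pitchfork_along_x h \<kappa>c \<or> pitchfork_along_y h \<kappa>c))"

text \<open>Conditions on the quartic coefficients of \<open>G\<close>. They say that the coefficient of the cubic
  term of the bifurcating component does not vanish: at \<open>\<kappa> = - 1 / (2 c\<^sub>1\<^sub>0 lam)\<close> the third
  \<open>x\<close>-derivative of \<^const>\<open>planar_y\<close> at the origin is
  \<open>1 - 24 \<kappa> c\<^sub>2\<^sub>0 (8 dpm + d0)\<close>, and at \<open>\<kappa> = - 1 / (2 c\<^sub>0\<^sub>1 lam)\<close> the third
  \<open>y\<close>-derivative of \<^const>\<open>planar_x\<close> there is \<open>24 \<kappa> c\<^sub>0\<^sub>2 (8 dpm + d0)\<close>.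
  Neither is excluded from being \<open>0\<close> by the other assumptions on \<open>G\<close>.\<close>

definition nondegenerate_position ::
    "(nat \<Rightarrow> nat \<Rightarrow> real) \<Rightarrow> real \<Rightarrow> nat \<Rightarrow> nat \<Rightarrow> bool" where
  "nondegenerate_position c lam dpm d0 \<longleftrightarrow>
     c 1 0 * lam + 12 * c 2 0 * (8 * real dpm + real d0) \<noteq> 0"

definition nondegenerate_momentum :: "(nat \<Rightarrow> nat \<Rightarrow> real) \<Rightarrow> bool" where
  "nondegenerate_momentum c \<longleftrightarrow> c 0 2 \<noteq> 0"

end

theory Submission
  imports Defs
begin

text \<open>
  On the axis \<open>y = 0\<close> the second component of the field is
  \<open>- sin x - \<kappa> (dpm G\<^sub>1\<^sub>0(2 x, 0) + d0 G\<^sub>1\<^sub>0(x, 0))\<close>: it is affine in \<open>\<kappa>\<close>, and its Taylor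
  coefficients at the origin come from those of \<open>G(x, 0) = \<Sum> c\<^sub>l\<^sub>0 x\<^sup>2\<^sup>l\<close>.
  Since \<open>G\<close> is even in each argument, the field is odd, which gives the vanishing of the even
  derivatives. Comparing an entry of \<open>L v = lam v\<close> at a node where \<open>v = \<plusminus>1\<close> yields
  \<open>lam = 2 dpm + d0\<close>; hence the linear coefficient is \<open>- 1 - 2 \<kappa> c\<^sub>1\<^sub>0 lam\<close>, which is zero
  exactly at the critical coupling and has nonzero slope in \<open>\<kappa>\<close> there. The cubic
  coefficient is nonzero by the nondegeneracy condition.

  The first component on the axis \<open>x = 0\<close> is treated in the same way, with the roles of the two
  arguments of \<open>G\<close> exchanged and \<open>- sin\<close> replaced by the identity. As the identity has no cubic
  term, nondegeneracy then reduces to \<open>c\<^sub>0\<^sub>2 \<noteq> 0\<close>.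

  The double series is only assumed to sum pointwise. Summing it first over one index
  turns every section of \<open>G\<close> into an everywhere convergent power series
  (\<open>even_section_sums\<close>), so that all derivatives exist and can be computed termwise.
\<close>

section \<open>Everywhere convergent power series\<close>

text \<open>Differentiating a power series termwise amounts to applying \<^const>\<open>diffs\<close> to its
  coefficients, so this is the \<open>k\<close>-th derivative wherever the series converges nearby.\<close>

definition power_series_deriv :: "(nat \<Rightarrow> real) \<Rightarrow> nat \<Rightarrow> real \<Rightarrow> real" where
  "power_series_deriv b k x = (\<Sum>n. (diffs ^^ k) b n * x ^ n)"

lemma fact_mult_iterated_diffs:
  "fact n * (diffs ^^ k) b n = (fact (n + k) * b (n + k) :: real)"
proof (induction k arbitrary: n)
  case 0
  then show ?case by simp
next
  case (Suc k)
  have "fact n * (diffs ^^ Suc k) b n = fact (Suc n) * (diffs ^^ k) b (Suc n)"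
    by (simp add: diffs_def)
  then show ?case by (simp only: Suc.IH add_Suc add_Suc_right)
qed

lemma power_series_deriv_at_0: "power_series_deriv b k 0 = fact k * b k"
  unfolding power_series_deriv_def powser_zero using fact_mult_iterated_diffs[of 0 k b] by simp

lemma DERIV_power_series_deriv:
  assumes "\<And>x :: real. summable (\<lambda>n. b n * x ^ n)"
  shows "(power_series_deriv b k has_real_derivative power_series_deriv b (Suc k) x) (at x)"
proof -
  have "summable (\<lambda>n. (diffs ^^ k) b n * x ^ n)" for x :: real
    using assms by (induction k arbitrary: x) (auto intro: termdiff_converges_all)
  then have "((\<lambda>x. \<Sum>n. (diffs ^^ k) b n * x ^ n) has_real_derivative
      (\<Sum>n. diffs ((diffs ^^ k) b) n * x ^ n)) (at x)"
    by (rule termdiffs_strong_converges_everywhere)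
  then show ?thesis unfolding power_series_deriv_def[abs_def] by simp
qed

section \<open>Sections of the interaction\<close>

text \<open>The coefficients of \<open>x \<mapsto> G x y\<close> as a power series in \<open>x\<close> rather than in
  \<open>x\<^sup>2\<close>, so that termwise differentiation applies directly.\<close>

definition even_section_coeff :: "(nat \<Rightarrow> nat \<Rightarrow> real) \<Rightarrow> real \<Rightarrow> nat \<Rightarrow> real" where
  "even_section_coeff c y n =
     (if even n then (\<Sum>\<^sub>\<infinity>m. c (n div 2) m * y ^ (2 * m)) else 0)"

lemma even_section_coeff_on_axis:
  "even_section_coeff c 0 n = (if even n then c (n div 2) 0 else 0)"
proof -
  have "(\<Sum>\<^sub>\<infinity>m. c l m * 0 ^ (2 * m)) = c l 0" for l
  proof -
    have "(\<Sum>\<^sub>\<infinity>m. c l m * 0 ^ (2 * m)) = (\<Sum>\<^sub>\<infinity>m\<in>{0}. c l m * 0 ^ (2 * m))"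
      by (rule infsum_cong_neutral) auto
    then show ?thesis by simp
  qed
  then show ?thesis by (simp add: even_section_coeff_def)
qed

text \<open>Unconditional summability of the double series permits iterated summation; the factor
  \<open>x\<^sup>2\<^sup>l\<close> can then be pulled out of the inner sum.\<close>

lemma even_section_sums:
  fixes c :: "nat \<Rightarrow> nat \<Rightarrow> real" and G :: "real \<Rightarrow> real \<Rightarrow> real"
  assumes G: "\<And>x y. ((\<lambda>(l, m). c l m * x ^ (2 * l) * y ^ (2 * m)) has_sum G x y) UNIV"
  shows "(\<lambda>n. even_section_coeff c y n * x ^ n) sums G x y"
proof -
  define a where "a l = (\<Sum>\<^sub>\<infinity>m. c l m * y ^ (2 * m))" for l
  \<comment> \<open>At \<open>x = 1\<close> the double sum shows that the coefficient series converge.\<close>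
  have inner: "((\<lambda>m. c l m * y ^ (2 * m)) has_sum a l) UNIV" for l
  proof -
    have "(\<lambda>(l, m). c l m * y ^ (2 * m)) summable_on UNIV \<times> UNIV"
      using has_sum_imp_summable[OF G[of 1 y]] by simp
    then have "(\<lambda>m. c l m * y ^ (2 * m)) summable_on UNIV"
      using summable_on_SigmaD1[of "\<lambda>l m. c l m * y ^ (2 * m)" UNIV "\<lambda>_. UNIV" l]
      by simp
    then show ?thesis unfolding a_def by (rule has_sum_infsum)
  qed
  have "((\<lambda>l. a l * x ^ (2 * l)) has_sum G x y) UNIV"
  proof (rule has_sum_SigmaD[where B = "\<lambda>_. UNIV"])
    show "((\<lambda>(l, m). c l m * x ^ (2 * l) * y ^ (2 * m)) has_sum G x y) (UNIV \<times> UNIV)"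
      using G[of x y] by simp
    show "((\<lambda>m. (\<lambda>(l, m). c l m * x ^ (2 * l) * y ^ (2 * m)) (l, m)) has_sum a l * x ^ (2 * l))
        UNIV" for l
      using has_sum_cmult_left[OF inner[of l], where c = "x ^ (2 * l)"] by (simp add: mult_ac)
  qed
  then have "(\<lambda>l. a l * x ^ (2 * l)) sums G x y" by (rule has_sum_imp_sums)
  then have "(\<lambda>l. even_section_coeff c y (2 * l) * x ^ (2 * l)) sums G x y"
    by (simp add: a_def even_section_coeff_def)
  then show ?thesis
    by (subst (asm) sums_mono_reindex)
      (auto simp: strict_mono_def even_section_coeff_def elim!: evenE)
qed

lemma section_eq_power_series:
  fixes c :: "nat \<Rightarrow> nat \<Rightarrow> real" and G :: "real \<Rightarrow> real \<Rightarrow> real"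
  assumes "\<And>x y. ((\<lambda>(l, m). c l m * x ^ (2 * l) * y ^ (2 * m)) has_sum G x y) UNIV"
  shows "(\<lambda>x. G x y) = power_series_deriv (even_section_coeff c y) 0"
  using sums_unique[OF even_section_sums[OF assms]] by (auto simp: power_series_deriv_def)

lemma DERIV_section:
  fixes c :: "nat \<Rightarrow> nat \<Rightarrow> real" and G :: "real \<Rightarrow> real \<Rightarrow> real"
  assumes "\<And>x y. ((\<lambda>(l, m). c l m * x ^ (2 * l) * y ^ (2 * m)) has_sum G x y) UNIV"
  shows "(power_series_deriv (even_section_coeff c y) k has_real_derivative
           power_series_deriv (even_section_coeff c y) (Suc k) x) (at x)"
  by (rule DERIV_power_series_deriv, rule sums_summable, rule even_section_sums[OF assms])

lemma deriv_section:
  fixes c :: "nat \<Rightarrow> nat \<Rightarrow> real" and G :: "real \<Rightarrow> real \<Rightarrow> real"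
  assumes "\<And>x y. ((\<lambda>(l, m). c l m * x ^ (2 * l) * y ^ (2 * m)) has_sum G x y) UNIV"
  shows "deriv (\<lambda>s. G s y) x = power_series_deriv (even_section_coeff c y) 1 x"
  unfolding section_eq_power_series[OF assms]
  using DERIV_imp_deriv[OF DERIV_section[OF assms]] by simp

text \<open>The derivative of an even function is odd, and \<open>G\<close> is even in both arguments
  because its terms are.\<close>

lemma deriv_section_odd:
  fixes c :: "nat \<Rightarrow> nat \<Rightarrow> real" and G :: "real \<Rightarrow> real \<Rightarrow> real"
  assumes G: "\<And>x y. ((\<lambda>(l, m). c l m * x ^ (2 * l) * y ^ (2 * m)) has_sum G x y) UNIV"
  shows "deriv (\<lambda>s. G s (- y)) (- x) = - deriv (\<lambda>s. G s y) x"
proof -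
  have even: "G (- s) y = G s y" "G s (- y) = G s y" for s
    using G[of "- s" y] G[of s "- y"] G[of s y] by (auto intro: has_sum_unique)
  have D: "((\<lambda>s. G s y) has_real_derivative deriv (\<lambda>s. G s y) z) (at z)" for z
    unfolding deriv_section[OF G] using DERIV_section[OF G, of y 0 z]
    by (simp add: section_eq_power_series[OF G])
  have "((\<lambda>s. G (- s) y) has_real_derivative - deriv (\<lambda>s. G s y) (- x)) (at x)"
    using DERIV_chain'[OF DERIV_minus[OF DERIV_ident] D, of x] by simp
  then have "deriv (\<lambda>s. G s y) x = - deriv (\<lambda>s. G s y) (- x)"
    unfolding even by (rule DERIV_imp_deriv)
  then show ?thesis by (simp add: even)
qed

section \<open>The eigenvalue in terms of the associated degrees\<close>

text \<open>At a node where \<open>v = \<plusminus>1\<close>, neighbours with the same value cancel between degree and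
  adjacency term, neighbours with the opposite value count twice, and those with value
  \<open>0\<close> count once.\<close>

lemma laplacian_eigenvalue_eq:
  fixes v :: "real^'n::finite"
  assumes eig: "eigenvector (laplacian E) v lam"
    and val: "bivalent v \<or> trivalent v"
    and deg: "associated_degrees E v dpm d0"
  shows "lam = 2 * real dpm + real d0"
proof -
  have v3: "v $ j \<in> {-1, 0, 1}" for j
    using val by (auto simp: bivalent_def trivalent_def)
  obtain i where i: "v $ i \<noteq> 0"
    using eig by (auto simp: eigenvector_def vec_eq_iff)
  have Lv: "(laplacian E *v v) $ i = (\<Sum>j\<in>UNIV. (if E i j then v $ i - v $ j else 0))"
  proof -
    have "(laplacian E *v v) $ i = (\<Sum>j\<in>UNIV. (if i = j then real (card {k. E i k}) * v $ j else 0)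
         - (if E i j then v $ j else 0))"
      unfolding matrix_vector_mult_def laplacian_def degree_matrix_def adjacency_matrix_def
      by (auto simp: algebra_simps intro!: sum.cong)
    also have "\<dots> = (\<Sum>j\<in>{k. E i k}. v $ i) - (\<Sum>j\<in>UNIV. if E i j then v $ j else 0)"
      by (simp add: sum_subtractf)
    also have "(\<Sum>j\<in>{k. E i k}. v $ i) = (\<Sum>j\<in>UNIV. if E i j then v $ i else 0)"
      by (simp add: sum.If_cases)
    finally show ?thesis by (simp add: sum_subtractf[symmetric] if_distrib cong: if_cong)
  qed
  have split: "(if E i j then v $ i - v $ j else 0) = v $ i *
      (2 * (if v $ j = - v $ i \<and> E i j then 1 else 0) + (if v $ j = 0 \<and> E i j then 1 else 0))" for j
    using v3[of j] v3[of i] i by auto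
  have "lam * v $ i = (laplacian E *v v) $ i"
    using eig by (simp add: eigenvector_def)
  also have "\<dots> = v $ i * (2 * real (card {j. v $ j = - v $ i \<and> E i j})
      + real (card {j. v $ j = 0 \<and> E i j}))"
    unfolding Lv split sum_distrib_left[symmetric] sum.distrib
    by (simp add: sum.If_cases)
  also have "card {j. v $ j = - v $ i \<and> E i j} = dpm"
    using v3[of i] i deg by (auto simp: associated_degrees_def)
  also have "card {j. v $ j = 0 \<and> E i j} = d0"
    using v3[of i] i deg by (auto simp: associated_degrees_def)
  finally show ?thesis using i by simp
qed

section \<open>Pitchfork conditions for a component affine in the coupling\<close>

text \<open>Here \<open>\<phi> k\<close> and \<open>\<psi> k\<close> are the \<open>k\<close>-th derivatives of the uncoupled and the
  coupling part. For affine dependence on \<open>\<kappa>\<close> the mixed derivative in the transversality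
  condition is the slope of the coupling part alone.\<close>

lemma pitchfork_along_x_affine:
  fixes \<phi> \<psi> :: "nat \<Rightarrow> real \<Rightarrow> real"
  assumes h: "\<And>x \<kappa>. h x 0 \<kappa> = \<phi> 0 x + \<kappa> * \<psi> 0 x"
    and D\<phi>: "\<And>k x. (\<phi> k has_real_derivative \<phi> (Suc k) x) (at x)"
    and D\<psi>: "\<And>k x. (\<psi> k has_real_derivative \<psi> (Suc k) x) (at x)"
    and even_zero: "\<phi> 0 0 = 0" "\<psi> 0 0 = 0" "\<phi> 2 0 = 0" "\<psi> 2 0 = 0"
    and critical: "\<phi> 1 0 + \<kappa>c * \<psi> 1 0 = 0"
    and transversal: "\<psi> 1 0 \<noteq> 0"
    and cubic: "\<phi> 3 0 + \<kappa>c * \<psi> 3 0 \<noteq> 0"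
  shows "pitchfork_along_x h \<kappa>c"
proof -
  have D: "((\<lambda>x. \<phi> k x + \<kappa> * \<psi> k x) has_real_derivative \<phi> (Suc k) x + \<kappa> * \<psi> (Suc k) x) (at x)"
    for k x \<kappa>
    by (intro DERIV_add DERIV_cmult D\<phi> D\<psi>)
  have D\<kappa>: "((\<lambda>\<kappa>. a + \<kappa> * b) has_real_derivative b) (at \<kappa>)" for a b \<kappa> :: real
    by (auto intro!: derivative_eq_intros)
  have p1: "partial_x h x 0 \<kappa> = \<phi> 1 x + \<kappa> * \<psi> 1 x" for x \<kappa>
    unfolding partial_x_def h using DERIV_imp_deriv[OF D, of 0] by simp
  have p2: "partial_x (partial_x h) x 0 \<kappa> = \<phi> 2 x + \<kappa> * \<psi> 2 x" for x \<kappa>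
    unfolding partial_x_def[of "partial_x h"] p1
    using DERIV_imp_deriv[OF D, of 1] by (simp add: numeral_2_eq_2)
  have p3: "partial_x (partial_x (partial_x h)) x 0 \<kappa> = \<phi> 3 x + \<kappa> * \<psi> 3 x" for x \<kappa>
    unfolding partial_x_def[of "partial_x (partial_x h)"] p2
    using DERIV_imp_deriv[OF D, of 2] by (simp add: numeral_2_eq_2 numeral_3_eq_3)
  have k0: "partial_kappa h 0 0 \<kappa>c = \<psi> 0 0"
    unfolding partial_kappa_def h by (rule DERIV_imp_deriv[OF D\<kappa>])
  have k1: "partial_kappa (partial_x h) 0 0 \<kappa>c = \<psi> 1 0"
    unfolding partial_kappa_def p1 by (rule DERIV_imp_deriv[OF D\<kappa>])
  have diff: "(\<lambda>x. \<phi> k x + \<kappa> * \<psi> k x) differentiable at x" for k x \<kappa>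
    using D real_differentiable_def by blast
  have diff\<kappa>: "(\<lambda>\<kappa>. a + \<kappa> * b) differentiable at \<kappa>" for a b \<kappa> :: real
    using D\<kappa> real_differentiable_def by blast
  have "pitchfork_derivatives_exist h \<kappa>c"
    unfolding pitchfork_derivatives_exist_def h p1 p2 by (simp only: diff diff\<kappa> eventually_True simp_thms)
  then show ?thesis
    unfolding pitchfork_along_x_def p1 p2 p3 k0 k1 h
    using even_zero critical transversal cubic by simp
qed

text \<open>The coupling term of either component of the planar field, on the axis of its pitchfork,
  is \<open>\<sigma>\<close> times \<open>a g(2 x) + b g(x)\<close> with \<open>g\<close> the derivative of a section of \<open>G\<close>. Its
  \<open>k\<close>-th derivative at \<open>0\<close> carries the weight \<open>2\<^sup>k a + b\<close>: this is the eigenvalue for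
  \<open>k = 1\<close>, and the source of \<open>8 a + b\<close> for \<open>k = 3\<close>.\<close>

lemma pitchfork_along_x_coupling:
  fixes c :: "nat \<Rightarrow> nat \<Rightarrow> real" and G :: "real \<Rightarrow> real \<Rightarrow> real"
    and \<phi> :: "nat \<Rightarrow> real \<Rightarrow> real"
  assumes G: "\<And>x y. ((\<lambda>(l, m). c l m * x ^ (2 * l) * y ^ (2 * m)) has_sum G x y) UNIV"
    and h: "\<And>x \<kappa>. h x 0 \<kappa> = \<phi> 0 x +
      \<kappa> * (\<sigma> * (a * deriv (\<lambda>s. G s 0) (2 * x) + b * deriv (\<lambda>s. G s 0) x))"
    and D\<phi>: "\<And>k x. (\<phi> k has_real_derivative \<phi> (Suc k) x) (at x)"
    and even_zero: "\<phi> 0 0 = 0" "\<phi> 2 0 = 0"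
    and critical: "\<phi> 1 0 + \<kappa>c * (\<sigma> * (2 * c 1 0 * (2 * a + b))) = 0"
    and transversal: "\<sigma> * (c 1 0 * (2 * a + b)) \<noteq> 0"
    and cubic: "\<phi> 3 0 + \<kappa>c * (\<sigma> * (24 * c 2 0 * (8 * a + b))) \<noteq> 0"
  shows "pitchfork_along_x h \<kappa>c"
proof -
  define F where "F = power_series_deriv (even_section_coeff c 0)"
  define \<psi> where "\<psi> k x = \<sigma> * (a * (2 ^ k * F (Suc k) (2 * x)) + b * F (Suc k) x)" for k x
  have DF: "(F k has_real_derivative F (Suc k) x) (at x)" for k x
    unfolding F_def by (rule DERIV_section[OF G])
  have D\<psi>: "(\<psi> k has_real_derivative \<psi> (Suc k) x) (at x)" for k x
  proof -
    have "((\<lambda>x. F (Suc k) (2 * x)) has_real_derivative F (Suc (Suc k)) (2 * x) * 2) (at x)"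
      by (rule DERIV_chain2[OF DF]) (auto intro!: derivative_eq_intros)
    then have "(\<psi> k has_real_derivative
        \<sigma> * (a * (2 ^ k * (F (Suc (Suc k)) (2 * x) * 2)) + b * F (Suc (Suc k)) x)) (at x)"
      unfolding \<psi>_def[abs_def] by (intro DERIV_cmult DERIV_add DF)
    then show ?thesis by (simp add: \<psi>_def mult_ac)
  qed
  have F0: "F k 0 = fact k * (if even k then c (k div 2) 0 else 0)" for k
    by (simp only: F_def power_series_deriv_at_0 even_section_coeff_on_axis)
  have \<psi>0: "\<psi> 0 0 = 0" "\<psi> 2 0 = 0" by (simp_all add: \<psi>_def F0)
  have \<psi>1: "\<psi> 1 0 = \<sigma> * (2 * c 1 0 * (2 * a + b))"
    by (simp add: \<psi>_def F0 algebra_simps)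
  have \<psi>3: "\<psi> 3 0 = \<sigma> * (24 * c 2 0 * (8 * a + b))"
    by (simp add: \<psi>_def F0 fact_numeral algebra_simps)
  show ?thesis
  proof (rule pitchfork_along_x_affine[of h \<phi> \<psi>])
    show "h x 0 \<kappa> = \<phi> 0 x + \<kappa> * \<psi> 0 x" for x \<kappa>
      by (simp add: h \<psi>_def F_def deriv_section[OF G])
  qed (use D\<phi> D\<psi> even_zero \<psi>0 critical transversal cubic in
      \<open>auto simp: \<psi>1[unfolded One_nat_def] \<psi>3\<close>)
qed

section \<open>The two pitchforks of the planar system\<close>

theorem proposition6:
  fixes E :: "'n::finite \<Rightarrow> 'n \<Rightarrow> bool"
    and v :: "real^'n" and lam :: real and dpm d0 :: nat
    and c :: "nat \<Rightarrow> nat \<Rightarrow> real" and G :: "real \<Rightarrow> real \<Rightarrow> real"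
  assumes "simple_graph E"
    and "eigenvector (laplacian E) v lam"
    and "bivalent v \<or> trivalent v"
    and "associated_degrees E v dpm d0"
    and "\<And>x y. ((\<lambda>(l, m). c l m * x ^ (2 * l) * y ^ (2 * m)) has_sum G x y) UNIV"
    and "\<And>x y. G x y \<ge> 0"
  shows "(\<forall>\<kappa>>0. planar_x G dpm d0 0 0 \<kappa> = 0 \<and> planar_y G dpm d0 0 0 \<kappa> = 0) \<and>
    (\<forall>\<kappa>>0. \<kappa> = - 1 / (2 * c 1 0 * lam) \<and> nondegenerate_position c lam dpm d0 \<longrightarrow>
       pitchfork_at_origin (planar_x G dpm d0) (planar_y G dpm d0) \<kappa>) \<and>
    (\<forall>\<kappa>>0. \<kappa> = - 1 / (2 * c 0 1 * lam) \<and> nondegenerate_momentum c \<longrightarrow>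
       pitchfork_at_origin (planar_x G dpm d0) (planar_y G dpm d0) \<kappa>)"
proof -
  note G = assms(5)
  have lam: "lam = 2 * real dpm + real d0"
    using assms(2-4) by (rule laplacian_eigenvalue_eq)
  have Gswap: "((\<lambda>(m, l). c l m * y ^ (2 * m) * x ^ (2 * l)) has_sum G x y) UNIV" for x y
    using G[of x y] has_sum_swap[where f = "\<lambda>(l, m). c l m * x ^ (2 * l) * y ^ (2 * m)" and A = UNIV and B = UNIV]
    by (simp add: mult_ac)
  have px: "planar_x G dpm d0 x y \<kappa> = y + \<kappa> * (1 * (real dpm * deriv (\<lambda>t. G (2 * x) t) (2 * y)
      + real d0 * deriv (\<lambda>t. G x t) y))" for x y \<kappa>
    by (simp add: planar_x_def mixed_partial_def algebra_simps)
  have py: "planar_y G dpm d0 x y \<kappa> = - sin x + \<kappa> * (- 1 * (real dpm * deriv (\<lambda>s. G s (2 * y)) (2 * x)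
      + real d0 * deriv (\<lambda>s. G s y) x))" for x y \<kappa>
    by (simp add: planar_y_def mixed_partial_def algebra_simps)
  have odd_x: "planar_x G dpm d0 (- x) (- y) \<kappa> = - planar_x G dpm d0 x y \<kappa>" for x y \<kappa>
    using deriv_section_odd[OF Gswap, of x y] deriv_section_odd[OF Gswap, of "2 * x" "2 * y"]
    by (simp add: px algebra_simps)
  have odd_y: "planar_y G dpm d0 (- x) (- y) \<kappa> = - planar_y G dpm d0 x y \<kappa>" for x y \<kappa>
    using deriv_section_odd[OF G, of y x] deriv_section_odd[OF G, of "2 * y" "2 * x"]
    by (simp add: py algebra_simps)
  have equilibrium: "planar_x G dpm d0 0 0 \<kappa> = 0 \<and> planar_y G dpm d0 0 0 \<kappa> = 0" for \<kappa>
    using odd_x[of 0 0 \<kappa>] odd_y[of 0 0 \<kappa>] by simp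
  have position: "pitchfork_at_origin (planar_x G dpm d0) (planar_y G dpm d0) \<kappa>"
    if "\<kappa> > 0" and \<kappa>: "\<kappa> = - 1 / (2 * c 1 0 * lam)" and nd: "nondegenerate_position c lam dpm d0" for \<kappa>
  proof -
    \<comment> \<open>Division by \<open>0\<close> would give \<open>\<kappa> = 0\<close>.\<close>
    have nz: "c 1 0 \<noteq> 0" "lam \<noteq> 0" using that by auto
    have lin: "2 * \<kappa> * c 1 0 * lam = - 1" using nz by (simp add: \<kappa>)
    have "pitchfork_along_x (planar_y G dpm d0) \<kappa>"
    \<comment> \<open>Shifting the phase by \<open>k\<close> quarter turns is a uniform formula for the \<open>k\<close>-th derivative
      of \<open>- sin\<close>.\<close>
    proof (rule pitchfork_along_x_coupling[OF G, where \<phi> = "\<lambda>k x. - sin (x + real k * (pi / 2))"])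
      show "planar_y G dpm d0 x 0 \<kappa> = - sin (x + real 0 * (pi / 2)) + \<kappa> * (- 1 *
          (real dpm * deriv (\<lambda>s. G s 0) (2 * x) + real d0 * deriv (\<lambda>s. G s 0) x))" for x \<kappa>
        by (simp add: py)
      show "((\<lambda>x. - sin (x + real k * (pi / 2))) has_real_derivative
          - sin (x + real (Suc k) * (pi / 2))) (at x)" for k x
      proof -
        have "x + real (Suc k) * (pi / 2) = (x + real k * (pi / 2)) + pi / 2"
          by (simp add: algebra_simps add_divide_distrib)
        then have "sin (x + real (Suc k) * (pi / 2)) = cos (x + real k * (pi / 2))"
          by (simp only: sin_add cos_pi_half sin_pi_half mult_zero_right mult_1_right add_0_left)
        then show ?thesis by (auto intro!: derivative_eq_intros)
      qed
      show "- sin (0 + real 1 * (pi / 2)) +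
          \<kappa> * (- 1 * (2 * c 1 0 * (2 * real dpm + real d0))) = 0"
        using lin by (simp add: lam mult_ac)
      show "- 1 * (c 1 0 * (2 * real dpm + real d0)) \<noteq> 0"
        using nz by (simp add: lam)
      \<comment> \<open>Multiplying by \<open>c\<^sub>1\<^sub>0 lam\<close> eliminates \<open>\<kappa>\<close> and leaves the nondegeneracy expression.\<close>
      have "c 1 0 * lam * (1 - 24 * \<kappa> * c 2 0 * (8 * real dpm + real d0))
          = c 1 0 * lam - 12 * (2 * \<kappa> * c 1 0 * lam) * c 2 0 * (8 * real dpm + real d0)"
        by algebra
      also have "\<dots> \<noteq> 0"
        unfolding lin using nd by (simp add: nondegenerate_position_def)
      finally have "1 - 24 * \<kappa> * c 2 0 * (8 * real dpm + real d0) \<noteq> 0" by auto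
      moreover have "sin (3 * pi / 2) = (- 1 :: real)" using sin_3over2_pi by simp
      ultimately show "- sin (0 + real 3 * (pi / 2)) +
          \<kappa> * (- 1 * (24 * c 2 0 * (8 * real dpm + real d0))) \<noteq> 0"
        by (simp add: mult_ac)
    qed auto
    then show ?thesis using odd_y by (auto simp: pitchfork_at_origin_def)
  qed
  have momentum: "pitchfork_at_origin (planar_x G dpm d0) (planar_y G dpm d0) \<kappa>"
    if "\<kappa> > 0" and \<kappa>: "\<kappa> = - 1 / (2 * c 0 1 * lam)" and nd: "nondegenerate_momentum c" for \<kappa>
  proof -
    have nz: "c 0 1 \<noteq> 0" "lam \<noteq> 0" using that by auto
    have lin: "2 * \<kappa> * c 0 1 * lam = - 1" using nz by (simp add: \<kappa>)
    have "pitchfork_along_y (planar_x G dpm d0) \<kappa>"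
      unfolding pitchfork_along_y_def
    proof (rule pitchfork_along_x_coupling[OF Gswap,
          where \<phi> = "\<lambda>k x. if k = 0 then x else if k = 1 then 1 else 0"])
      show "planar_x G dpm d0 0 x \<kappa> = (if (0::nat) = 0 then x else if (0::nat) = 1 then 1 else 0) +
          \<kappa> * (1 * (real dpm * deriv (\<lambda>s. G 0 s) (2 * x) + real d0 * deriv (\<lambda>s. G 0 s) x))" for x \<kappa>
        by (simp add: px)
      show "((\<lambda>x. if k = 0 then x else if k = 1 then 1 else 0) has_real_derivative
          (if Suc k = 0 then x else if Suc k = 1 then 1 else 0)) (at x)" for k :: nat and x :: real
        by (cases "k = 0"; cases "k = 1") auto
      show "(if (1::nat) = 0 then 0 else if (1::nat) = 1 then 1 else 0) +
          \<kappa> * (1 * (2 * c 0 1 * (2 * real dpm + real d0))) = 0"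
        using lin by (simp add: lam mult_ac)
      show "1 * (c 0 1 * (2 * real dpm + real d0)) \<noteq> 0"
        using nz by (simp add: lam)
      \<comment> \<open>The degrees are nonnegative and, as \<open>lam \<noteq> 0\<close>, not both zero.\<close>
      have "8 * real dpm + real d0 \<noteq> 0" using nz(2) lam by linarith
      then show "(if (3::nat) = 0 then 0 else if (3::nat) = 1 then 1 else 0) +
          \<kappa> * (1 * (24 * c 0 2 * (8 * real dpm + real d0))) \<noteq> 0"
        using \<open>\<kappa> > 0\<close> nd by (simp add: nondegenerate_momentum_def)
    qed auto
    then show ?thesis using odd_x by (auto simp: pitchfork_at_origin_def)
  qed
  show ?thesis using equilibrium position momentum by blast
qed

end
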